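(* The critical probability $p_c$ of oriented bond percolation in two dimensions satisfies $p_c\ge 0.63328$.
   Context: Let $\mathcal V=\{(n,m): n\in\{0,1,2,\dots\},\ m\in\mathbb Z,\ n+m\text{ even}\}$. From each site $(n,m)\in\mathcal V$ there are two oriented bonds, one to $(n+1,m-1)$ and one to $(n+1,m+1)$. Each bond is independently open with probability $p\in[0,1]$ and closed with probability $1-p$. The critical probability is $p_c=\sup\{p\in[0,1]:\theta(p)=0\}$, where $\theta(p)$ is the probability that for every $n$ there is an oriented path of open bonds from $(0,0)$ to some site $(n,m)\in\mathcal V$. *)

theory Defs
  imports "HOL-Probability.Probability"
begin

definition sites :: "(nat \<times> int) set" where
  "sites = {(n, m). even (int n + m)}"

type_synonym bond = "(nat \<times> int) \<times> (nat \<times> int)"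

definition bonds :: "bond set" where
  "bonds = {((n, m), (n', m')). (n, m) \<in> sites \<and> n' = n + 1 \<and> (m' = m - 1 \<or> m' = m + 1)}"

text \<open>A configuration assigns to each bond whether it is open.\<close>

definition percolation :: "real \<Rightarrow> (bond \<Rightarrow> bool) measure" where
  "percolation p = (\<Pi>\<^sub>M b\<in>bonds. measure_pmf (bernoulli_pmf p))"

definition open_path :: "(bond \<Rightarrow> bool) \<Rightarrow> nat \<times> int \<Rightarrow> nat \<times> int \<Rightarrow> bool" where
  "open_path \<omega> = (\<lambda>x y. (x, y) \<in> bonds \<and> \<omega> (x, y))\<^sup>*\<^sup>*"

definition percolation_prob :: "real \<Rightarrow> real" where
  "percolation_prob p = measure (percolation p)
     {\<omega> \<in> space (percolation p). \<forall>n. \<exists>m. (n, m) \<in> sites \<and> open_path \<omega> (0, 0) (n, m)}"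

definition critical_prob :: real where
  "critical_prob = Sup {p \<in> {0..1}. percolation_prob p = 0}"

text \<open>
  The event below is measurable, and the supremum is over a nonempty bounded set, so that neither
  definition falls back on a junk value.
\<close>

lemma percolation_event_sets:
  "{\<omega> \<in> space (percolation p). \<forall>n. \<exists>m. (n, m) \<in> sites \<and> open_path \<omega> (0, 0) (n, m)}
     \<in> sets (percolation p)"
proof -
  have step: "Measurable.pred (percolation p) (\<lambda>\<omega>. (x, y) \<in> bonds \<and> \<omega> (x, y))" for x y
  proof (cases "(x, y) \<in> bonds")
    case True
    have "(\<lambda>\<omega>. \<omega> (x, y)) \<in> percolation p \<rightarrow>\<^sub>M measure_pmf (bernoulli_pmf p)"
      unfolding percolation_def using True by (rule measurable_component_singleton)
    then show ?thesis
      using True by (simp cong: measurable_cong_sets)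
  qed simp
  have iter: "Measurable.pred (percolation p)
      (\<lambda>\<omega>. ((\<lambda>x y. (x, y) \<in> bonds \<and> \<omega> (x, y)) ^^ k) x z)" for k and x z
  proof (induction k arbitrary: z)
    case 0
    show ?case by simp
  next
    case (Suc k)
    show ?case
      unfolding relpowp.simps relcompp_apply
      by (intro pred_intros_countable pred_intros_logic Suc step)
  qed
  have "Measurable.pred (percolation p) (\<lambda>\<omega>. open_path \<omega> x y)" for x y
    unfolding open_path_def rtranclp_power by (intro pred_intros_countable iter)
  then show ?thesis
    by (intro predE pred_intros_countable pred_intros_logic) auto
qed

lemma percolation_prob_0: "percolation_prob 0 = 0"
proof -
  interpret product_prob_space "\<lambda>_. measure_pmf (bernoulli_pmf 0)" bonds
    by standard
  have closed: "AE \<omega> in percolation 0. \<forall>b\<in>bonds. \<not> \<omega> b"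
    unfolding percolation_def
  proof (subst AE_ball_countable)
    show "\<forall>b\<in>bonds. AE \<omega> in PiM bonds (\<lambda>_. measure_pmf (bernoulli_pmf 0)). \<not> \<omega> b"
    proof
      fix b assume b: "b \<in> bonds"
      show "AE \<omega> in PiM bonds (\<lambda>_. measure_pmf (bernoulli_pmf 0)). \<not> \<omega> b"
        by (rule AE_component[OF b]) (auto simp: AE_measure_pmf_iff set_pmf_eq bernoulli_pmf.rep_eq)
    qed
  qed auto
  have "AE \<omega> in percolation 0. \<not> (\<forall>n. \<exists>m. (n, m) \<in> sites \<and> open_path \<omega> (0, 0) (n, m))"
    using closed
  proof eventually_elim
    case (elim \<omega>)
    then have "open_path \<omega> x y \<Longrightarrow> x = y" for x y
      unfolding open_path_def by (auto elim: rtranclp.cases)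
    then have "\<not> open_path \<omega> (0, 0) (1, m)" for m by fastforce
    then show ?case by blast
  qed
  then have "emeasure (percolation 0)
      {\<omega> \<in> space (percolation 0). \<forall>n. \<exists>m. (n, m) \<in> sites \<and> open_path \<omega> (0, 0) (n, m)} = 0"
    using percolation_event_sets[of 0] by (subst (asm) AE_iff_measurable[OF _ refl]) auto
  then show ?thesis by (simp add: percolation_prob_def measure_def)
qed

end

theory Submission
  imports Defs
begin

text \<open>
  Let \<open>A\<^sub>n\<close> be the set of sites of level \<open>n\<close> reached from the origin. If \<open>h > 0\<close> is a function of the
  occupation of the ten sites behind the rightmost site of \<open>A\<^sub>n\<close> such that
  \<open>F(A) = x powr (- max A / 2) * h(A)\<close>, with \<open>F({}) = 0\<close>, satisfies \<open>E F(A\<^sub>n\<^sub>+\<^sub>1) \<le> r * E F(A\<^sub>n)\<close> for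
  some \<open>x < 1\<close> and \<open>r < 1\<close>, then \<open>P(max A\<^sub>n \<ge> 0)\<close> decays exponentially. By reflection so does
  \<open>P(min A\<^sub>n \<le> 0)\<close>, hence the percolation probability vanishes. The drift inequality involves only
  finitely many patterns once the sites beyond the window are replaced by the worst case, and it holds
  at \<open>p = 1297 / 2048 > 0.63328\<close>, \<open>x = 511 / 512\<close> for a suitable table \<open>h\<close>. It is checked by rewriting
  with integers rounded in the safe direction.
\<close>

subsection \<open>Patterns behind the edge\<close>

datatype 'a dtree = Leaf 'a | Node "'a dtree" "'a dtree"

primrec look :: "'a dtree \<Rightarrow> (nat \<Rightarrow> bool) \<Rightarrow> 'a" where
  "look (Leaf v) a = v"
| "look (Node l r) a = (if a 0 then look r (a \<circ> Suc) else look l (a \<circ> Suc))"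

definition occ :: "real \<Rightarrow> bool \<Rightarrow> bool \<Rightarrow> real" where
  "occ p c b = (if c \<and> b then 1 - (1 - p)\<^sup>2 else if c \<or> b then p else 0)"

text \<open>\<open>occ p c b\<close> is the probability that a site with parents occupied according to \<open>c\<close> and \<open>b\<close>
  becomes occupied. A pattern lists occupations from the edge inwards; the children of the pattern
  \<open>c, a 0, a 1, \<dots>\<close> are independent, and \<open>mean\<close> and \<open>mean_score\<close> are the expectations of \<open>look\<close> and
  \<open>score\<close> at the pattern of the children. In \<open>score\<close>, each empty site in front of the edge costs a
  factor \<open>x\<close>, and the edge is searched for among the first \<open>n\<close> sites only.\<close>

primrec mean :: "real \<Rightarrow> real dtree \<Rightarrow> bool \<Rightarrow> (nat \<Rightarrow> bool) \<Rightarrow> real" where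
  "mean p (Leaf v) c a = v"
| "mean p (Node l r) c a =
     occ p c (a 0) * mean p r (a 0) (a \<circ> Suc) + (1 - occ p c (a 0)) * mean p l (a 0) (a \<circ> Suc)"

primrec score :: "real \<Rightarrow> real dtree \<Rightarrow> nat \<Rightarrow> (nat \<Rightarrow> bool) \<Rightarrow> real" where
  "score x h 0 b = 0"
| "score x h (Suc n) b = (if b 0 then look h (b \<circ> Suc) else x * score x h n (b \<circ> Suc))"

primrec mean_score :: "real \<Rightarrow> real \<Rightarrow> real dtree \<Rightarrow> nat \<Rightarrow> bool \<Rightarrow> (nat \<Rightarrow> bool) \<Rightarrow> real" where
  "mean_score p x h 0 c a = 0"
| "mean_score p x h (Suc n) c a = occ p c (a 0) * mean p h (a 0) (a \<circ> Suc)
     + (1 - occ p c (a 0)) * (x * mean_score p x h n (a 0) (a \<circ> Suc))"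

lemma occ_bounds:
  assumes "0 \<le> p" "p \<le> 1"
  shows "0 \<le> occ p c b" "occ p c b \<le> 1"
  using assms power_le_one[of "1 - p" 2] by (auto simp: occ_def)

lemma convex_le:
  fixes u v u' v' t :: real
  assumes "0 \<le> t" "t \<le> 1" "u \<le> u'" "v \<le> v'"
  shows "t * u + (1 - t) * v \<le> t * u' + (1 - t) * v'"
  using assms by (intro add_mono mult_left_mono) auto

lemma look_in_set: "look h a \<in> set_dtree h"
  by (induction h arbitrary: a) auto

lemma mean_ge:
  assumes "0 \<le> p" "p \<le> 1" "\<And>v. v \<in> set_dtree h \<Longrightarrow> lo \<le> v"
  shows "lo \<le> mean p h c a"
  using assms(3)
proof (induction h arbitrary: c a)
  case (Node l r)
  then have "lo \<le> mean p l (a 0) (a \<circ> Suc)" "lo \<le> mean p r (a 0) (a \<circ> Suc)" by auto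
  from convex_le[OF occ_bounds[OF assms(1,2)] this(2,1)] show ?case
    by (simp add: algebra_simps)
qed auto

lemma mean_le:
  assumes "0 \<le> p" "p \<le> 1" "\<And>v. v \<in> set_dtree h \<Longrightarrow> v \<le> hi"
  shows "mean p h c a \<le> hi"
  using assms(3)
proof (induction h arbitrary: c a)
  case (Node l r)
  then have "mean p l (a 0) (a \<circ> Suc) \<le> hi" "mean p r (a 0) (a \<circ> Suc) \<le> hi" by auto
  from convex_le[OF occ_bounds[OF assms(1,2)] this(2,1)] show ?case
    by (simp add: algebra_simps)
qed auto

lemma mean_score_nonneg:
  assumes "0 \<le> p" "p \<le> 1" "0 \<le> x" "\<And>v. v \<in> set_dtree h \<Longrightarrow> 0 \<le> v"
  shows "0 \<le> mean_score p x h n c a"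
proof (induction n arbitrary: c a)
  case (Suc n)
  show ?case
    using occ_bounds[OF assms(1,2), of c "a 0"] Suc assms(3)
      mean_ge[OF assms(1,2), of h 0 "a 0" "a \<circ> Suc"] assms(4) by simp
qed simp

subsection \<open>Expectations over finitely many bonds\<close>

text \<open>A finite product is computed one bond at a time; bonds outside \<open>J\<close> count as
  closed.\<close>

definition ebern :: "real \<Rightarrow> 'b set \<Rightarrow> (('b \<Rightarrow> bool) \<Rightarrow> real) \<Rightarrow> real" where
  "ebern p J f = measure_pmf.expectation (Pi_pmf J False (\<lambda>_. bernoulli_pmf p)) f"

lemma finite_set_Pi_bern: "finite J \<Longrightarrow> finite (set_pmf (Pi_pmf J False (\<lambda>_. bernoulli_pmf p)))"
  by (rule finite_subset[OF set_Pi_pmf_subset']) auto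

lemma ebern_empty: "ebern p {} f = f (\<lambda>_. False)"
  by (simp add: ebern_def)

lemma ebern_const: "ebern p J (\<lambda>_. c) = c"
  by (simp add: ebern_def)

lemma ebern_cmult: "ebern p J (\<lambda>w. c * f w) = c * ebern p J f"
  by (simp add: ebern_def)

lemma ebern_mono:
  assumes "finite J" "\<And>w. f w \<le> g w"
  shows "ebern p J f \<le> ebern p J g"
  unfolding ebern_def
  by (intro integral_mono integrable_measure_pmf_finite finite_set_Pi_bern assms)

lemma ebern_insert:
  assumes p: "0 \<le> p" "p \<le> 1" and J: "finite J" "b \<notin> J"
  shows "ebern p (insert b J) f
    = p * ebern p J (\<lambda>w. f (w(b := True))) + (1 - p) * ebern p J (\<lambda>w. f (w(b := False)))"
proof -
  let ?P = "Pi_pmf J False (\<lambda>_. bernoulli_pmf p)"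
  have "Pi_pmf (insert b J) False (\<lambda>_. bernoulli_pmf p)
      = bernoulli_pmf p \<bind> (\<lambda>y. map_pmf (\<lambda>w. w(b := y)) ?P)"
    using J by (subst Pi_pmf_insert') (auto simp: map_pmf_def)
  then have "ebern p (insert b J) f = measure_pmf.expectation (bernoulli_pmf p)
      (\<lambda>y. measure_pmf.expectation (map_pmf (\<lambda>w. w(b := y)) ?P) f)"
    unfolding ebern_def
    by (simp, subst pmf_expectation_bind[where A = UNIV])
      (auto intro: finite_set_Pi_bern J simp: integral_measure_pmf[where A = UNIV])
  then show ?thesis
    using p by (simp add: integral_bernoulli_pmf ebern_def)
qed

lemma ebern_union:
  assumes p: "0 \<le> p" "p \<le> 1" and "finite J" "finite L" "J \<inter> L = {}"
  shows "ebern p (J \<union> L) f = ebern p J (\<lambda>w. ebern p L (\<lambda>w'. f (\<lambda>b. if b \<in> J then w b else w' b)))"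
  using assms(3,5)
proof (induction J arbitrary: f rule: finite_induct)
  case empty
  then show ?case by (simp add: ebern_empty)
next
  case (insert b J)
  have *: "(\<lambda>c. if c \<in> J then w c else w' c)(b := y)
      = (\<lambda>c. if c \<in> insert b J then (w(b := y)) c else w' c)" for w w' y
    using insert.hyps by auto
  have "b \<notin> J \<union> L" "finite (J \<union> L)" "J \<inter> L = {}" using insert assms by auto
  then show ?case
    by (simp only: Un_insert_left ebern_insert[OF p] insert.IH insert.hyps * not_False_eq_True)
qed

lemma ebern_site:
  assumes p: "0 \<le> p" "p \<le> 1" and J: "finite J" "u \<notin> J" "v \<notin> J" "u \<noteq> v"
    and f: "\<And>w y z. f (w(u := y, v := z)) = (if c \<and> y \<or> b \<and> z then f1 w else f0 w)"
  shows "ebern p (insert u (insert v J)) f = occ p c b * ebern p J f1 + (1 - occ p c b) * ebern p J f0"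
proof -
  have f': "f (w(v := z, u := y)) = (if c \<and> y \<or> b \<and> z then f1 w else f0 w)" for w y z
    using f[of w y z] J(4) by (simp add: fun_upd_twist)
  show ?thesis
    using J by (simp add: ebern_insert[OF p] f')
      (auto simp: occ_def algebra_simps power2_eq_square)
qed

subsection \<open>One step of the process\<close>

text \<open>Indices are shifted by one, so that \<open>P 0\<close> can stand for the absent parent
  beyond the edge of the cone.\<close>

definition arrive :: "(nat \<Rightarrow> bool) \<Rightarrow> (nat \<Rightarrow> 'b) \<Rightarrow> (nat \<Rightarrow> 'b) \<Rightarrow> ('b \<Rightarrow> bool) \<Rightarrow> nat \<Rightarrow> bool" where
  "arrive P u v w i \<longleftrightarrow> P i \<and> w (u i) \<or> P (Suc i) \<and> w (v i)"

context
  fixes p :: real and u v :: "nat \<Rightarrow> 'b" and P :: "nat \<Rightarrow> bool" and k :: nat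
  assumes p: "0 \<le> p" "p \<le> 1"
    and uv: "inj u" "inj v" "\<And>i j. u i \<noteq> v j"
    and P: "\<And>i. k \<le> i \<Longrightarrow> \<not> P i"
begin

text \<open>The bonds \<open>u j\<close> and \<open>v j\<close> lead into child \<open>j\<close>
  only, so its state is independent of all later children and can be integrated out first.\<close>

lemma ebern_arrive_step:
  "ebern p (u ` {j..<k} \<union> v ` {j..<k}) (\<lambda>w. if arrive P u v w j
      then f (\<lambda>i. arrive P u v w (Suc j + i)) else g (\<lambda>i. arrive P u v w (Suc j + i)))
   = occ p (P j) (P (Suc j)) *
        ebern p (u ` {Suc j..<k} \<union> v ` {Suc j..<k}) (\<lambda>w. f (\<lambda>i. arrive P u v w (Suc j + i)))
   + (1 - occ p (P j) (P (Suc j))) *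
        ebern p (u ` {Suc j..<k} \<union> v ` {Suc j..<k}) (\<lambda>w. g (\<lambda>i. arrive P u v w (Suc j + i)))"
proof (cases "j < k")
  case True
  then have "{j..<k} = insert j {Suc j..<k}" by auto
  then have J: "u ` {j..<k} \<union> v ` {j..<k}
      = insert (u j) (insert (v j) (u ` {Suc j..<k} \<union> v ` {Suc j..<k}))"
    by auto
  have vu: "v i \<noteq> u l" for i l
    using uv(3) by metis
  have new: "u j \<notin> u ` {Suc j..<k} \<union> v ` {Suc j..<k}" "v j \<notin> u ` {Suc j..<k} \<union> v ` {Suc j..<k}"
    using uv vu by (auto simp: inj_eq)
  show ?thesis
    unfolding J
  proof (rule ebern_site[OF p _ new uv(3)])
    fix w y z
    have "arrive P u v (w(u j := y, v j := z)) (Suc j + i) = arrive P u v w (Suc j + i)" for i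
      using uv vu by (auto simp: arrive_def inj_eq)
    moreover have "arrive P u v (w(u j := y, v j := z)) j \<longleftrightarrow> P j \<and> y \<or> P (Suc j) \<and> z"
      using uv vu by (auto simp: arrive_def)
    ultimately show "(if arrive P u v (w(u j := y, v j := z)) j
        then f (\<lambda>i. arrive P u v (w(u j := y, v j := z)) (Suc j + i))
        else g (\<lambda>i. arrive P u v (w(u j := y, v j := z)) (Suc j + i)))
      = (if P j \<and> y \<or> P (Suc j) \<and> z then f (\<lambda>i. arrive P u v w (Suc j + i))
        else g (\<lambda>i. arrive P u v w (Suc j + i)))"
      by simp
  qed simp
next
  \<comment> \<open>No parent is left from \<open>k\<close> on: child \<open>j\<close> is empty and
    \<open>occ\<close> is 0.\<close>
  case False
  then show ?thesis
    using P by (simp add: arrive_def occ_def)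
qed

lemma ebern_look:
  "ebern p (u ` {j..<k} \<union> v ` {j..<k}) (\<lambda>w. look h (\<lambda>i. arrive P u v w (j + i)))
    = mean p h (P j) (\<lambda>i. P (Suc j + i))"
proof (induction h arbitrary: j)
  case (Node l r)
  show ?case
    using ebern_arrive_step[of j "look r" "look l"] Node.IH[of "Suc j"]
    by (simp add: comp_def cong: if_cong)
qed (simp add: ebern_const)

lemma ebern_score:
  "ebern p (u ` {j..<k} \<union> v ` {j..<k}) (\<lambda>w. score x h n (\<lambda>i. arrive P u v w (j + i)))
    = mean_score p x h n (P j) (\<lambda>i. P (Suc j + i))"
proof (induction n arbitrary: j)
  case (Suc n)
  show ?case
    using ebern_arrive_step[of j "look h" "\<lambda>b. x * score x h n b"] Suc.IH[of "Suc j"]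
      ebern_look[of "Suc j" h]
    by (simp add: comp_def ebern_cmult cong: if_cong)
qed (simp add: ebern_const)

end

text \<open>The edge has index at most \<open>i\<close>, and powers of \<open>x\<close> decrease.
  This lower bound serves Markov's inequality.\<close>

lemma score_ge:
  assumes "0 < x" "x \<le> 1" "0 < lo" "\<And>v. v \<in> set_dtree h \<Longrightarrow> lo \<le> v" "b i" "i \<le> M" "M < n"
  shows "lo * x ^ M \<le> score x h n b"
  using assms(5-)
proof (induction n arbitrary: b i M)
  case (Suc n)
  show ?case
  proof (cases "b 0")
    case True
    have "lo * x ^ M \<le> lo * 1"
      using assms by (intro mult_left_mono power_le_one) auto
    also have "\<dots> \<le> look h (b \<circ> Suc)" using assms(4) look_in_set by fastforce
    finally show ?thesis using True by simp
  next
    case False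
    then obtain i' where i: "i = Suc i'" using Suc.prems by (cases i) auto
    obtain M' where M: "M = Suc M'" using Suc.prems i by (cases M) auto
    have "lo * x ^ M' \<le> score x h n (b \<circ> Suc)"
      using Suc.prems i M by (intro Suc.IH[of _ i']) auto
    then have "x * (lo * x ^ M') \<le> x * score x h n (b \<circ> Suc)"
      using assms(1) by (intro mult_left_mono) auto
    then show ?thesis using False M by (simp add: mult_ac)
  qed
qed simp

lemma score_nonneg:
  assumes "0 \<le> x" "\<And>v. v \<in> set_dtree h \<Longrightarrow> 0 \<le> v"
  shows "0 \<le> score x h n b"
  using assms(1) by (induction n arbitrary: b) (auto intro: assms(2) look_in_set)

subsection \<open>Sites reached, counted from one edge\<close>

text \<open>\<open>i\<close> counts the sites of level \<open>n\<close> from the extreme one inwards, from the right for \<open>d = 1\<close> and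
  from the left for \<open>d = -1\<close>. For \<open>i = 0\<close> the bond \<open>inward d n i\<close> starts outside the cone of the
  origin and is never used.\<close>

definition site :: "int \<Rightarrow> nat \<Rightarrow> int \<Rightarrow> nat \<times> int" where
  "site d n i = (n, d * (int n - 2 * i))"

definition inward :: "int \<Rightarrow> nat \<Rightarrow> nat \<Rightarrow> bond" where
  "inward d n i = (site d n (int i - 1), site d (Suc n) (int i))"

definition outward :: "int \<Rightarrow> nat \<Rightarrow> nat \<Rightarrow> bond" where
  "outward d n i = (site d n (int i), site d (Suc n) (int i))"

primrec reach :: "int \<Rightarrow> (bond \<Rightarrow> bool) \<Rightarrow> nat \<Rightarrow> nat \<Rightarrow> bool" where
  "reach d w 0 = (\<lambda>i. i = 0)"
| "reach d w (Suc n) = arrive (case_nat False (reach d w n)) (inward d n) (outward d n) w"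

definition level_bonds :: "int \<Rightarrow> nat \<Rightarrow> nat \<Rightarrow> bond set" where
  "level_bonds d k n = inward d n ` {0..<k} \<union> outward d n ` {0..<k}"

definition past_bonds :: "int \<Rightarrow> nat \<Rightarrow> nat \<Rightarrow> bond set" where
  "past_bonds d k n = (\<Union>m<n. level_bonds d k m)"

lemma finite_level_bonds: "finite (level_bonds d k n)"
  by (simp add: level_bonds_def)

lemma finite_past_bonds: "finite (past_bonds d k n)"
  by (simp add: past_bonds_def finite_level_bonds)

lemma past_bonds_Suc: "past_bonds d k (Suc n) = past_bonds d k n \<union> level_bonds d k n"
  by (auto simp: past_bonds_def lessThan_Suc)

text \<open>Past bonds start below level \<open>n\<close>. Hence the bonds leaving level
  \<open>n\<close> are independent of the past.\<close>

lemma not_past: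
  "inward d n i \<notin> past_bonds d k n" "outward d n i \<notin> past_bonds d k n"
  by (auto simp: past_bonds_def level_bonds_def inward_def outward_def site_def)

lemma past_bonds_subset:
  assumes "\<bar>d\<bar> = 1"
  shows "past_bonds d k n \<subseteq> bonds"
proof -
  have "d = 1 \<or> d = -1" using assms by linarith
  then show ?thesis
    by (auto simp: past_bonds_def level_bonds_def inward_def outward_def site_def bonds_def sites_def)
qed

lemma inward_outward:
  assumes "d \<noteq> 0"
  shows "inj (inward d n)" "inj (outward d n)" "inward d n i \<noteq> outward d n j"
  using assms by (auto simp: inj_def inward_def outward_def site_def)

lemma reach_support: "reach d w n i \<Longrightarrow> i \<le> n"
proof (induction n arbitrary: i)
  case (Suc n)
  then show ?case
    by (force simp: arrive_def split: nat.splits)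
qed simp

text \<open>Along a path, an outward bond keeps the index and an inward bond raises it by
  one.\<close>

lemma open_path_reach:
  assumes d: "\<bar>d\<bar> = 1" and path: "open_path w (0, 0) y"
  shows "\<exists>i. y = site d (fst y) (int i) \<and> reach d w (fst y) i"
  using path unfolding open_path_def
proof (induction rule: rtranclp_induct)
  case base
  show ?case by (simp add: site_def)
next
  case (step y z)
  then obtain i where y: "y = site d (fst y) (int i)" and i: "reach d w (fst y) i" by blast
  define n where "n = fst y"
  have yz: "(y, z) \<in> bonds" "w (y, z)" using step by auto
  have "z = site d (Suc n) (int i) \<or> z = site d (Suc n) (int (Suc i))"
    using yz(1) y d by (cases z) (auto simp: n_def bonds_def site_def abs_eq_iff')
  then show ?case
  proof
    assume z: "z = site d (Suc n) (int i)"
    then have "(y, z) = outward d n i" using y by (simp add: outward_def n_def)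
    then have "reach d w (Suc n) i" using i yz(2) by (simp add: arrive_def n_def)
    then show ?thesis using z by (intro exI[of _ i]) (simp add: site_def)
  next
    assume z: "z = site d (Suc n) (int (Suc i))"
    then have "(y, z) = inward d n (Suc i)" using y by (simp add: inward_def n_def)
    then have "reach d w (Suc n) (Suc i)" using i yz(2) by (simp add: arrive_def n_def)
    then show ?thesis using z by (intro exI[of _ "Suc i"]) (simp add: site_def)
  qed
qed

text \<open>No index from \<open>k\<close> on is reached by level \<open>n < k\<close>, so bonds
  into such sites do not matter.\<close>

lemma reach_cong:
  assumes "n < k" "\<And>b. b \<in> past_bonds d k n \<Longrightarrow> w b = w' b"
  shows "reach d w n = reach d w' n"
  using assms
proof (induction n)
  case (Suc n)
  have IH: "reach d w n = reach d w' n"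
    using Suc by (auto simp: past_bonds_Suc)
  show ?case
  proof
    fix i
    show "reach d w (Suc n) i = reach d w' (Suc n) i"
    proof (cases "i < k")
      case True
      then have "inward d n i \<in> past_bonds d k (Suc n)" "outward d n i \<in> past_bonds d k (Suc n)"
        by (auto simp: past_bonds_Suc level_bonds_def)
      then show ?thesis using Suc.prems(2) by (simp add: IH arrive_def)
    next
      case False
      then show ?thesis using reach_support[of d _ "Suc n" i] Suc.prems(1) by (meson leD le_trans not_less)
    qed
  qed
qed simp

text \<open>Markov property: given the past, the next level is one step from the present pattern,
  with \<open>False\<close> as the absent outermost parent. Each level costs a factor
  \<open>K\<close>.\<close>

lemma ebern_score_reach:
  assumes p: "0 \<le> p" "p \<le> 1" and d: "d \<noteq> 0" and K: "0 \<le> K" and n: "n < k"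
    and drift: "\<And>a. mean_score p x h m False a \<le> K * score x h m a"
  shows "ebern p (past_bonds d k n) (\<lambda>w. score x h m (reach d w n)) \<le> K ^ n * score x h m (\<lambda>i. i = 0)"
  using n
proof (induction n)
  case 0
  show ?case by (simp add: ebern_const)
next
  case (Suc n)
  let ?J = "past_bonds d k n" and ?L = "level_bonds d k n"
  let ?P = "\<lambda>w. case_nat False (reach d w n)"
  have disj: "?J \<inter> ?L = {}"
    using not_past by (auto simp: level_bonds_def)
  have reach: "reach d (\<lambda>b. if b \<in> ?J then w b else w' b) (Suc n)
      = arrive (?P w) (inward d n) (outward d n) w'" for w w'
  proof -
    have "reach d (\<lambda>b. if b \<in> ?J then w b else w' b) n = reach d w n"
      using Suc.prems by (intro reach_cong[of _ k]) auto
    then show ?thesis by (intro ext) (simp add: arrive_def not_past)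
  qed
  have P: "k \<le> i \<Longrightarrow> \<not> ?P w i" for i w
    using Suc.prems reach_support[of d w n "i - 1"] by (auto split: nat.splits)
  have "ebern p (past_bonds d k (Suc n)) (\<lambda>w. score x h m (reach d w (Suc n)))
      = ebern p ?J (\<lambda>w. ebern p ?L
          (\<lambda>w'. score x h m (arrive (?P w) (inward d n) (outward d n) w')))"
    unfolding past_bonds_Suc
    by (subst ebern_union[OF p finite_past_bonds finite_level_bonds disj]) (simp only: reach)
  also have "\<dots> = ebern p ?J (\<lambda>w. mean_score p x h m False (reach d w n))"
    using ebern_score[where j = 0, OF p inward_outward[OF d] P] by (simp add: level_bonds_def)
  also have "\<dots> \<le> ebern p ?J (\<lambda>w. K * score x h m (reach d w n))"
    by (intro ebern_mono finite_past_bonds drift)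
  also have "\<dots> = K * ebern p ?J (\<lambda>w. score x h m (reach d w n))"
    by (rule ebern_cmult)
  also have "\<dots> \<le> K * (K ^ n * score x h m (\<lambda>i. i = 0))"
    using Suc K by (intro mult_left_mono) auto
  finally show ?case by simp
qed

subsection \<open>Extinction\<close>

text \<open>The event is a finite union of cylinders, one for each admissible state of
  \<open>J\<close>, whose measures are the point masses of \<open>Pi_pmf\<close>; the union bound
  adds them up.\<close>

lemma percolation_cylinder:
  assumes p: "0 \<le> p" "p \<le> 1" and J: "finite J" "J \<subseteq> bonds"
    and Q: "\<forall>w w'. (\<forall>b\<in>J. w b = w' b) \<longrightarrow> Q w = Q w'"
  shows "{w \<in> space (percolation p). Q w} \<in> sets (percolation p)"
    and "measure (percolation p) {w \<in> space (percolation p). Q w} \<le> ebern p J (\<lambda>w. of_bool (Q w))"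
proof -
  interpret product_prob_space "\<lambda>_. measure_pmf (bernoulli_pmf p)" bonds by standard
  let ?M = "percolation p"
  let ?F = "PiE_dflt J False (\<lambda>_. UNIV) \<inter> {f. Q f}"
  let ?C = "\<lambda>f. {w \<in> space ?M. \<forall>b\<in>J. w b \<in> {f b}}"
  have finF: "finite ?F" using J(1) by (intro finite_Int disjI1 finite_PiE_dflt) auto
  have C: "?C f \<in> sets ?M" and mC: "measure ?M (?C f) = (\<Prod>b\<in>J. pmf (bernoulli_pmf p) (f b))" for f
  proof -
    have eq: "?C f = prod_emb bonds (\<lambda>_. measure_pmf (bernoulli_pmf p)) J (\<Pi>\<^sub>E b\<in>J. {f b})"
      unfolding percolation_def using J(2)
      by (auto simp: prod_emb_def space_PiM PiE_iff extensional_def)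
    show "?C f \<in> sets ?M"
      unfolding eq unfolding percolation_def using J by (intro sets_PiM_I) auto
    show "measure ?M (?C f) = (\<Prod>b\<in>J. pmf (bernoulli_pmf p) (f b))"
      unfolding eq unfolding percolation_def using J by (subst measure_PiM_emb) (auto simp: measure_pmf_single)
  qed
  have eq: "{w \<in> space ?M. Q w} = (\<Union>f\<in>?F. ?C f)"
  proof (intro equalityI subsetI)
    fix w assume w: "w \<in> {w \<in> space ?M. Q w}"
    let ?f = "\<lambda>b. if b \<in> J then w b else False"
    have "Q ?f" using w Q[rule_format, of w ?f] by auto
    then show "w \<in> (\<Union>f\<in>?F. ?C f)"
      using w by (intro UN_I[of ?f]) (auto simp: PiE_dflt_def)
  next
    fix w assume "w \<in> (\<Union>f\<in>?F. ?C f)"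
    then obtain f where "Q f" "\<forall>b\<in>J. w b = f b" "w \<in> space ?M" by auto
    then show "w \<in> {w \<in> space ?M. Q w}" using Q[rule_format, of w f] by auto
  qed
  show "{w \<in> space ?M. Q w} \<in> sets ?M"
    unfolding eq using finF C by (intro sets.finite_UN) auto
  interpret percolation: prob_space ?M
    unfolding percolation_def by (rule prob_space_PiM) (simp add: prob_space_measure_pmf)
  have "measure ?M {w \<in> space ?M. Q w} \<le> (\<Sum>f\<in>?F. measure ?M (?C f))"
    unfolding eq using finF C by (intro percolation.finite_measure_subadditive_finite) auto
  also have "\<dots> = (\<Sum>f\<in>?F. pmf (Pi_pmf J False (\<lambda>_. bernoulli_pmf p)) f)"
    by (intro sum.cong refl, subst mC, subst pmf_Pi') (auto simp: J PiE_dflt_def)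
  also have "\<dots> = (\<Sum>f\<in>PiE_dflt J False (\<lambda>_. UNIV).
      pmf (Pi_pmf J False (\<lambda>_. bernoulli_pmf p)) f * of_bool (Q f))"
    using J by (intro sum.mono_neutral_cong_left) auto
  also have "\<dots> = ebern p J (\<lambda>w. of_bool (Q w))"
    unfolding ebern_def
  proof (subst integral_measure_pmf[of "PiE_dflt J False (\<lambda>_. UNIV)"])
    show "f \<in> PiE_dflt J False (\<lambda>_. UNIV)" if "f \<in> set_pmf (Pi_pmf J False (\<lambda>_. bernoulli_pmf p))" for f
      using that set_Pi_pmf_subset[OF J(1), of False "\<lambda>_. bernoulli_pmf p"] by (auto simp: PiE_dflt_def)
  qed (use J in auto)
  finally show "measure ?M {w \<in> space ?M. Q w} \<le> ebern p J (\<lambda>w. of_bool (Q w))" .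
qed

text \<open>Markov's inequality at level \<open>2 * n\<close>. As \<open>score\<close> lacks the
  factor \<open>x powr (- n / 2)\<close> that F has at level \<open>n\<close>, \<open>K\<close>
  plays the role of \<open>r * sqrt x\<close>, and \<open>K\<^sup>2 < x\<close> says
  \<open>r < 1\<close>.\<close>

lemma percolation_prob_eq_0:
  assumes p: "0 \<le> p" "p \<le> 1" and x: "0 < x" "x \<le> 1" and K: "0 \<le> K" "K\<^sup>2 < x"
    and lo: "0 < lo" "\<And>v. v \<in> set_dtree h \<Longrightarrow> lo \<le> v"
    and drift: "\<And>m a. mean_score p x h m False a \<le> K * score x h m a"
  shows "percolation_prob p = 0"
proof -
  let ?M = "percolation p"
  interpret percolation: prob_space ?M
    unfolding percolation_def by (rule prob_space_PiM) (simp add: prob_space_measure_pmf)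
  define S where "S = {w \<in> space ?M. \<forall>n. \<exists>m. (n, m) \<in> sites \<and> open_path w (0, 0) (n, m)}"
  \<comment> \<open>On level \<open>2 * n\<close>, index at most \<open>n\<close> means lying on
    side \<open>d\<close> of the axis or on the axis.\<close>
  define H where "H d n = {w \<in> space ?M. \<exists>i\<le>n. reach d w (2 * n) i}" for d n
  define c where "c = look h (\<lambda>_. False) / lo"
  have H: "H d n \<in> sets ?M" "measure ?M (H d n) \<le> c * (K\<^sup>2 / x) ^ n" if d: "\<bar>d\<bar> = 1" for d n
  proof -
    let ?J = "past_bonds d (2 * n + 1) (2 * n)"
    let ?Q = "\<lambda>w. \<exists>i\<le>n. reach d w (2 * n) i"
    have Q: "\<forall>w w'. (\<forall>b\<in>?J. w b = w' b) \<longrightarrow> ?Q w = ?Q w'"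
    proof (intro allI impI)
      fix w w' :: "bond \<Rightarrow> bool"
      assume "\<forall>b\<in>?J. w b = w' b"
      then have "reach d w (2 * n) = reach d w' (2 * n)"
        by (intro reach_cong[of _ "2 * n + 1"]) auto
      then show "?Q w = ?Q w'" by (simp only:)
    qed
    note cyl = percolation_cylinder[where J = ?J and Q = ?Q, OF p finite_past_bonds past_bonds_subset[OF d] Q]
    show "H d n \<in> sets ?M" unfolding H_def by (rule cyl(1))
    have "measure ?M (H d n) \<le> ebern p ?J (\<lambda>w. of_bool (?Q w))"
      unfolding H_def by (rule cyl(2))
    \<comment> \<open>Truncation at \<open>Suc n\<close> searches exactly the indices 0 to
      \<open>n\<close> that occur in \<open>H\<close>.\<close>
    also have "\<dots> \<le> ebern p ?J (\<lambda>w. 1 / (lo * x ^ n) * score x h (Suc n) (reach d w (2 * n)))"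
    proof (rule ebern_mono[OF finite_past_bonds])
      fix w
      show "of_bool (?Q w) \<le> 1 / (lo * x ^ n) * score x h (Suc n) (reach d w (2 * n))"
      proof (cases "?Q w")
        case True
        then obtain i where "i \<le> n" "reach d w (2 * n) i" by blast
        then have "lo * x ^ n \<le> score x h (Suc n) (reach d w (2 * n))"
          using lo x by (intro score_ge) auto
        then show ?thesis using True lo x by (simp add: field_simps)
      next
        case False
        then have "of_bool (?Q w) = (0 :: real)" by (simp only: of_bool_eq)
        moreover have "0 \<le> score x h (Suc n) (reach d w (2 * n))"
          using x lo by (intro score_nonneg) force+
        then have "0 \<le> 1 / (lo * x ^ n) * score x h (Suc n) (reach d w (2 * n))"
          using lo x by (intro mult_nonneg_nonneg) auto
        ultimately show ?thesis by (simp only:)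
      qed
    qed
    also have "\<dots> = 1 / (lo * x ^ n) * ebern p ?J (\<lambda>w. score x h (Suc n) (reach d w (2 * n)))"
      by (rule ebern_cmult)
    also have "\<dots> \<le> 1 / (lo * x ^ n) * (K ^ (2 * n) * score x h (Suc n) (\<lambda>i. i = 0))"
      using d lo x K(1) by (intro mult_left_mono ebern_score_reach p drift) auto
    also have "\<dots> = c * (K\<^sup>2 / x) ^ n"
      by (simp add: c_def power_mult power_divide comp_def)
    finally show "measure ?M (H d n) \<le> c * (K\<^sup>2 / x) ^ n" .
  qed
  have S: "S \<subseteq> H 1 n \<union> H (- 1) n" for n
  proof
    fix w assume w: "w \<in> S"
    then obtain m where path: "open_path w (0, 0) (2 * n, m)" by (auto simp: S_def)
    obtain i j where i: "(2 * n, m) = site 1 (2 * n) (int i)" "reach 1 w (2 * n) i"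
      and j: "(2 * n, m) = site (- 1) (2 * n) (int j)" "reach (- 1) w (2 * n) j"
      using open_path_reach[OF _ path, of 1] open_path_reach[OF _ path, of "- 1"] by auto
    \<comment> \<open>Equating the two expressions for \<open>m\<close> gives
      \<open>i + j = 2 * n\<close>.\<close>
    have "i \<le> n \<or> j \<le> n" using i(1) j(1) by (auto simp: site_def)
    then show "w \<in> H 1 n \<union> H (- 1) n" using w i j by (auto simp: H_def S_def)
  qed
  have "measure ?M S \<le> 2 * c * (K\<^sup>2 / x) ^ n" for n
  proof -
    have "measure ?M S \<le> measure ?M (H 1 n \<union> H (- 1) n)"
      using S H by (intro percolation.finite_measure_mono) auto
    also have "\<dots> \<le> measure ?M (H 1 n) + measure ?M (H (- 1) n)"
      using H by (intro measure_Un_le) auto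
    finally show ?thesis using H(2)[of 1 n] H(2)[of "- 1" n] by simp
  qed
  moreover have "(\<lambda>n. 2 * c * (K\<^sup>2 / x) ^ n) \<longlonglongrightarrow> 2 * c * 0"
    using K x by (intro tendsto_mult_left LIMSEQ_power_zero) simp
  ultimately have "measure ?M S \<le> 0"
    by (intro LIMSEQ_le_const[of _ 0]) auto
  then show ?thesis
    by (simp add: percolation_prob_def S_def measure_le_0_iff)
qed

subsection \<open>Binary arithmetic by rewriting\<close>

text \<open>The least significant bit is outermost. With bits as constructors, every operation is a
  set of plain rewrite rules.\<close>

datatype bits = End | B0 bits | B1 bits

primrec num_of :: "bits \<Rightarrow> nat" where
  "num_of End = 0"
| "num_of (B0 a) = 2 * num_of a"
| "num_of (B1 a) = 2 * num_of a + 1"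

fun encode :: "nat \<Rightarrow> bits" where
  "encode n = (if n = 0 then End else if even n then B0 (encode (n div 2)) else B1 (encode (n div 2)))"

declare encode.simps [simp del]

lemma encode_numeral:
  "encode 0 = End" "encode 1 = B1 End" "encode (numeral num.One) = B1 End"
  "encode (numeral (num.Bit0 k)) = B0 (encode (numeral k))"
  "encode (numeral (num.Bit1 k)) = B1 (encode (numeral k))"
  by (simp_all add: encode.simps[of 0] encode.simps[of 1] encode.simps[of "Suc 0"]
      encode.simps[of "numeral (num.Bit0 k)"] encode.simps[of "numeral (num.Bit1 k)"])

primrec inc :: "bits \<Rightarrow> bits" where
  "inc End = B1 End"
| "inc (B0 a) = B1 a"
| "inc (B1 a) = B0 (inc a)"

fun add :: "bits \<Rightarrow> bits \<Rightarrow> bits" and addc :: "bits \<Rightarrow> bits \<Rightarrow> bits" where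
  "add End b = b"
| "add (B0 a) End = B0 a"
| "add (B1 a) End = B1 a"
| "add (B0 a) (B0 b) = B0 (add a b)"
| "add (B0 a) (B1 b) = B1 (add a b)"
| "add (B1 a) (B0 b) = B1 (add a b)"
| "add (B1 a) (B1 b) = B0 (addc a b)"
| "addc End b = inc b"
| "addc (B0 a) End = B1 a"
| "addc (B1 a) End = B0 (inc a)"
| "addc (B0 a) (B0 b) = B1 (add a b)"
| "addc (B0 a) (B1 b) = B0 (addc a b)"
| "addc (B1 a) (B0 b) = B0 (addc a b)"
| "addc (B1 a) (B1 b) = B1 (addc a b)"

primrec half :: "bits \<Rightarrow> bits" where
  "half End = End"
| "half (B0 a) = a"
| "half (B1 a) = a"

fun avg :: "bits \<Rightarrow> bits \<Rightarrow> bits" where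
  "avg End b = half b"
| "avg (B0 a) End = a"
| "avg (B1 a) End = a"
| "avg (B0 a) (B0 b) = add a b"
| "avg (B0 a) (B1 b) = add a b"
| "avg (B1 a) (B0 b) = add a b"
| "avg (B1 a) (B1 b) = addc a b"

text \<open>Starting from the low end, a differing bit matters only if the higher bits agree, so it
  selects \<open>le\<close> or \<open>lt\<close> for them.\<close>

fun le :: "bits \<Rightarrow> bits \<Rightarrow> bool" and lt :: "bits \<Rightarrow> bits \<Rightarrow> bool" where
  "le End b = True"
| "le (B0 a) End = le a End"
| "le (B1 a) End = False"
| "le (B0 a) (B0 b) = le a b"
| "le (B0 a) (B1 b) = le a b"
| "le (B1 a) (B0 b) = lt a b"
| "le (B1 a) (B1 b) = le a b"
| "lt a End = False"
| "lt End (B0 b) = lt End b"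
| "lt End (B1 b) = True"
| "lt (B0 a) (B0 b) = lt a b"
| "lt (B0 a) (B1 b) = le a b"
| "lt (B1 a) (B0 b) = lt a b"
| "lt (B1 a) (B1 b) = lt a b"

primrec choose_bits :: "bool \<Rightarrow> bits \<Rightarrow> bits \<Rightarrow> bits" where
  "choose_bits True a b = a"
| "choose_bits False a b = b"

definition min_bits :: "bits \<Rightarrow> bits \<Rightarrow> bits" where
  "min_bits a b = choose_bits (le a b) a b"

section \<open>Correctness of the binary operations\<close>

lemma num_of_inc: "num_of (inc a) = num_of a + 1"
  by (induction a) auto

lemma num_of_add:
  "num_of (add a b) = num_of a + num_of b" "num_of (addc a b) = num_of a + num_of b + 1"
  by (induction a b and a b rule: add_addc.induct) (auto simp: num_of_inc)

lemma num_of_avg: "num_of (avg a b) = (num_of a + num_of b) div 2"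
  by (cases "(a, b)" rule: avg.cases; cases b) (auto simp: num_of_add)

lemma le_lt_num_of:
  "le a b \<longleftrightarrow> num_of a \<le> num_of b" "lt a b \<longleftrightarrow> num_of a < num_of b"
  by (induction a b and a b rule: le_lt.induct) auto

lemma num_of_min_bits: "num_of (min_bits a b) = min (num_of a) (num_of b)"
  by (cases "le a b") (auto simp: min_bits_def le_lt_num_of)

lemma avg_le:
  assumes "real (num_of a) \<le> x" "real (num_of b) \<le> y"
  shows "real (num_of (avg a b)) \<le> (x + y) / 2"
proof -
  have "2 * num_of (avg a b) \<le> num_of a + num_of b" by (simp add: num_of_avg)
  then have "2 * real (num_of (avg a b)) \<le> real (num_of a) + real (num_of b)"
    by (metis of_nat_add of_nat_le_iff of_nat_mult of_nat_numeral)
  then show ?thesis using assms by simp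
qed

subsection \<open>Bounding the drift\<close>

text \<open>1297 is the least numerator over 2048 that reaches 0.63328.\<close>

definition p0 :: real where "p0 = 1297 / 2048"
definition x0 :: real where "x0 = 511 / 512"
text \<open>1025 is the least numerator over \<open>2 ^ 20\<close> for which
  \<open>K0\<^sup>2 < x0\<close>; being \<open>2 ^ 10 + 1\<close>, it multiplies by one shift and
  one addition.\<close>

definition K0 :: real where "K0 = 1 - 1025 / 2 ^ 20"

definition cap :: bits where
  "cap = B0 (B0 (B0 (B0 (B0 (B0 (B0 (B0 (B0 (B0 (B0 (B0
    (B0 (B0 (B0 (B0 (B0 (B0 (B0 (B0 (B0 (B0 (B0 (B0 (B1 End))))))))))))))))))))))))"

text \<open>All weights are close to the maximum \<open>2 ^ 24\<close>, so the trees store the small defects from it;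
  rounding a defect down rounds the weight up.\<close>

definition weight :: "bits \<Rightarrow> real" where
  "weight g = 2 ^ 24 - real (num_of g)"

text \<open>The successive averages read off the binary expansion 0.10100010001 of \<open>p0\<close>, respectively
  0.111111111 of \<open>x0\<close>.\<close>

definition mix :: "bits \<Rightarrow> bits \<Rightarrow> bits" where
  "mix g f = avg g (avg f (avg g (avg f (avg f (avg f (avg g (avg f (avg f (avg f (avg g f))))))))))"

definition discount :: "bits \<Rightarrow> bits" where
  "discount g = avg g (avg g (avg g (avg g (avg g (avg g (avg g (avg g (avg g cap))))))))"

primrec shift10 :: "bits \<Rightarrow> bits" where
  "shift10 End = End"
| "shift10 (B0 a) = B0 (B0 (B0 (B0 (B0 (B0 (B0 (B0 (B0 (B0 (B0 a))))))))))"
| "shift10 (B1 a) = B0 (B0 (B0 (B0 (B0 (B0 (B0 (B0 (B0 (B0 (B1 a))))))))))"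

text \<open>This is \<open>weight g \<le> K0 * weight f\<close> times \<open>2 ^ 20\<close>,
  rearranged to avoid subtraction.\<close>

definition shrinks :: "bits \<Rightarrow> bits \<Rightarrow> bool" where
  "shrinks g f \<longleftrightarrow> le (add (shift10 (shift10 f)) (add cap (shift10 cap)))
     (add (shift10 (shift10 g)) (add f (shift10 f)))"

lemma num_of_cap: "num_of cap = 2 ^ 24"
  by (simp add: cap_def)

lemma num_of_shift10: "num_of (shift10 a) = 2 ^ 10 * num_of a"
  by (cases a) auto

lemma weight_mix: "p0 * weight g + (1 - p0) * weight f \<le> weight (mix g f)"
proof -
  let ?g = "real (num_of g)" and ?f = "real (num_of f)"
  have "real (num_of (mix g f)) \<le> (?g + (?f + (?g + (?f + (?f + (?f + (?g + (?f + (?f + (?f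
      + (?g + ?f) / 2) / 2) / 2) / 2) / 2) / 2) / 2) / 2) / 2) / 2) / 2"
    unfolding mix_def by (intro avg_le order_refl)
  also have "\<dots> = p0 * ?g + (1 - p0) * ?f"
    by (simp add: p0_def field_simps)
  finally show ?thesis
    by (simp add: weight_def algebra_simps)
qed

text \<open>\<open>cap\<close> is the defect of weight 0, so averaging with it only scales the
  weight.\<close>

lemma weight_discount: "x0 * weight g \<le> weight (discount g)"
proof -
  let ?g = "real (num_of g)" and ?c = "real (num_of cap)"
  have "real (num_of (discount g)) \<le> (?g + (?g + (?g + (?g + (?g + (?g + (?g + (?g + (?g
      + ?c) / 2) / 2) / 2) / 2) / 2) / 2) / 2) / 2) / 2"
    unfolding discount_def by (intro avg_le order_refl)
  also have "\<dots> = x0 * ?g + (1 - x0) * ?c"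
    by (simp add: x0_def field_simps)
  finally show ?thesis
    by (simp add: weight_def num_of_cap algebra_simps)
qed

lemma weight_shrinks:
  assumes "shrinks g f"
  shows "weight g \<le> K0 * weight f"
proof -
  have "2 ^ 20 * num_of f + 1025 * 2 ^ 24 \<le> 2 ^ 20 * num_of g + 1025 * num_of f"
    using assms by (simp add: shrinks_def le_lt_num_of num_of_add num_of_shift10 num_of_cap)
  then have "real (2 ^ 20 * num_of f + 1025 * 2 ^ 24) \<le> real (2 ^ 20 * num_of g + 1025 * num_of f)"
    by (simp only: of_nat_le_iff)
  then show ?thesis
    by (simp add: weight_def K0_def field_simps)
qed

section \<open>Operations on trees of defects\<close>

fun zip_dtree :: "('a \<Rightarrow> 'b \<Rightarrow> 'c) \<Rightarrow> 'a dtree \<Rightarrow> 'b dtree \<Rightarrow> 'c dtree" where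
  "zip_dtree f (Leaf u) (Leaf v) = Leaf (f u v)"
| "zip_dtree f (Node l r) (Node l' r') = Node (zip_dtree f l l') (zip_dtree f r r')"
| "zip_dtree f (Node l r) (Leaf v) = Node (zip_dtree f l (Leaf v)) (zip_dtree f r (Leaf v))"
| "zip_dtree f (Leaf u) (Node l r) = Node (zip_dtree f (Leaf u) l) (zip_dtree f (Leaf u) r)"

text \<open>Forgets the farthest site, in favour of the larger weight.\<close>

fun squash :: "bits dtree \<Rightarrow> bits dtree" where
  "squash (Leaf u) = Leaf u"
| "squash (Node (Leaf u) (Leaf v)) = Leaf (min_bits u v)"
| "squash (Node (Node l r) t) = Node (squash (Node l r)) (squash t)"
| "squash (Node (Leaf u) (Node l r)) = Node (Leaf u) (squash (Node l r))"

lemma look_zip_dtree: "look (zip_dtree f s t) a = f (look s a) (look t a)"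
  by (induction f s t arbitrary: a rule: zip_dtree.induct) auto

lemma look_map_dtree: "look (map_dtree f t) a = f (look t a)"
  by (induction t arbitrary: a) auto

lemma weight_squash: "weight (look t a) \<le> weight (look (squash t) a)"
proof (induction t arbitrary: a rule: squash.induct)
  case (3 l r t)
  show ?case using 3[of "a \<circ> Suc"] by (cases "a 0") (simp_all add: comp_def split: if_split)
next
  case (4 u l r)
  show ?case using 4[of "a \<circ> Suc"] by (cases "a 0") (simp_all add: comp_def split: if_split)
qed (auto simp: weight_def num_of_min_bits)

text \<open>Pairs of trees hold bounds for the two states of the site preceding the window. In
  \<open>combine_aux\<close>, mixing twice yields the probability \<open>1 - (1 - p0)\<^sup>2\<close> of two occupied parents.\<close>

fun combine :: "bits dtree \<times> bits dtree \<Rightarrow> bits dtree \<times> bits dtree \<Rightarrow> bits dtree \<times> bits dtree"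
  and combine_aux :: "bits dtree \<Rightarrow> bits dtree \<Rightarrow> bits dtree \<Rightarrow> bits dtree \<Rightarrow> bits dtree \<times> bits dtree"
  where
  "combine (l0, l1) (r0, r1) = combine_aux l0 (zip_dtree mix r0 l0) r1 (zip_dtree mix r1 l1)"
| "combine_aux l0 m0 r1 m1 = (Node l0 m1, Node m0 (zip_dtree mix r1 m1))"

primrec mean_trees :: "bits dtree \<Rightarrow> bits dtree \<times> bits dtree" where
  "mean_trees (Leaf g) = (Leaf g, Leaf g)"
| "mean_trees (Node l r) = combine (mean_trees l) (mean_trees r)"

fun map_both :: "('a \<Rightarrow> 'b) \<Rightarrow> 'a \<times> 'a \<Rightarrow> 'b \<times> 'b" where
  "map_both f (s, t) = (f s, f t)"

text \<open>When the edge retreats by one site, the expectation would depend on a site beyond the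
  window; \<open>squash\<close> takes the worst case there. After \<open>n\<close> retreats the
  bound is the maximal weight, that of \<open>End\<close>.\<close>

primrec score_trees :: "nat \<Rightarrow> bits dtree \<times> bits dtree \<Rightarrow> bits dtree \<times> bits dtree" where
  "score_trees 0 s = (Leaf End, Leaf End)"
| "score_trees (Suc n) s
    = combine (map_both (map_dtree discount) (score_trees n (map_both squash s))) s"

text \<open>Taking the mean trees as an argument \<open>s\<close> lets them be evaluated once for
  both uses.\<close>

definition certifies_aux :: "nat \<Rightarrow> bits dtree \<Rightarrow> bits dtree \<times> bits dtree \<Rightarrow> bool" where
  "certifies_aux n h s \<longleftrightarrow> pred_dtree (\<lambda>b. b) (zip_dtree shrinks
     (zip_dtree mix (snd s) (map_dtree discount (snd (score_trees n (map_both squash s))))) h)"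

definition certifies :: "nat \<Rightarrow> bits dtree \<Rightarrow> bool" where
  "certifies n h \<longleftrightarrow> pred_dtree (\<lambda>g. lt g cap) h \<and> certifies_aux n h (mean_trees h)"

definition bounds :: "(bool \<Rightarrow> (nat \<Rightarrow> bool) \<Rightarrow> real) \<Rightarrow> bits dtree \<times> bits dtree \<Rightarrow> bool" where
  "bounds f t \<longleftrightarrow>
     (\<forall>a. f False a \<le> weight (look (fst t) a) \<and> f True a \<le> weight (look (snd t) a))"

section \<open>The trees bound the expectations from above\<close>

lemma p0: "0 \<le> p0" "p0 \<le> 1"
  by (simp_all add: p0_def)

lemma weight_zip_mix:
  assumes "u \<le> weight (look s a)" "v \<le> weight (look t a)"
  shows "p0 * u + (1 - p0) * v \<le> weight (look (zip_dtree mix s t) a)"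
  using convex_le[OF p0 assms] weight_mix[of "look s a" "look t a"] by (simp add: look_zip_dtree)

lemma bounds_combine:
  assumes "bounds f l" "bounds g r"
  shows "bounds (\<lambda>c a. occ p0 c (a 0) * g (a 0) (a \<circ> Suc)
      + (1 - occ p0 c (a 0)) * f (a 0) (a \<circ> Suc)) (combine l r)"
  unfolding bounds_def
proof
  fix a :: "nat \<Rightarrow> bool"
  obtain l0 l1 r0 r1 where lr: "l = (l0, l1)" "r = (r0, r1)" by (metis surj_pair)
  let ?a = "a \<circ> Suc"
  have f: "f False ?a \<le> weight (look l0 ?a)" "f True ?a \<le> weight (look l1 ?a)"
    and g: "g False ?a \<le> weight (look r0 ?a)" "g True ?a \<le> weight (look r1 ?a)"
    using assms by (simp_all add: bounds_def lr)
  have sq: "(1 - (1 - p0)\<^sup>2) * g True ?a + (1 - p0)\<^sup>2 * f True ?a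
      = p0 * g True ?a + (1 - p0) * (p0 * g True ?a + (1 - p0) * f True ?a)"
    by (simp add: power2_eq_square algebra_simps)
  show "occ p0 False (a 0) * g (a 0) ?a + (1 - occ p0 False (a 0)) * f (a 0) ?a
        \<le> weight (look (fst (combine l r)) a)
      \<and> occ p0 True (a 0) * g (a 0) ?a + (1 - occ p0 True (a 0)) * f (a 0) ?a
        \<le> weight (look (snd (combine l r)) a)"
  proof (cases "a 0")
    case True
    then show ?thesis
      using weight_zip_mix[OF g(2) f(2)] weight_zip_mix[OF g(2) weight_zip_mix[OF g(2) f(2)]]
      by (simp add: lr occ_def sq)
  next
    case False
    then show ?thesis
      using f(1) weight_zip_mix[OF g(1) f(1)] by (simp add: lr occ_def)
  qed
qed

lemma bounds_mean_trees: "bounds (mean p0 (map_dtree weight h)) (mean_trees h)"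
proof (induction h)
  case (Leaf g)
  show ?case by (simp add: bounds_def)
next
  case (Node l r)
  show ?case
    using bounds_combine[OF Node.IH] unfolding bounds_def by simp
qed

lemma bounds_squash:
  assumes "bounds f t"
  shows "bounds f (map_both squash t)"
proof -
  have "u \<le> weight (look (squash s) a)" if "u \<le> weight (look s a)" for u s a
    using that weight_squash by (rule order_trans)
  then show ?thesis
    using assms by (cases t) (simp add: bounds_def)
qed

lemma bounds_discount:
  assumes "bounds f t"
  shows "bounds (\<lambda>c a. x0 * f c a) (map_both (map_dtree discount) t)"
proof -
  have "x0 * u \<le> weight (look (map_dtree discount s) a)" if "u \<le> weight (look s a)" for u s a
  proof -
    have "x0 * u \<le> x0 * weight (look s a)" using that by (simp add: x0_def)
    also have "\<dots> \<le> weight (look (map_dtree discount s) a)"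
      by (simp add: look_map_dtree weight_discount)
    finally show ?thesis .
  qed
  then show ?thesis
    using assms by (cases t) (simp add: bounds_def)
qed

context
  fixes h :: "bits dtree"
  assumes h: "pred_dtree (\<lambda>g. lt g cap) h"
begin

lemma weight_leaf: "v \<in> set_dtree (map_dtree weight h) \<Longrightarrow> 1 \<le> v \<and> v \<le> 2 ^ 24"
  using h by (auto simp: dtree.set_map dtree.pred_set weight_def le_lt_num_of num_of_cap)

lemma score_ge_0: "0 \<le> mean_score p0 x0 (map_dtree weight h) n c a"
proof (rule mean_score_nonneg[OF p0])
  show "0 \<le> v" if "v \<in> set_dtree (map_dtree weight h)" for v
    using weight_leaf[OF that] by linarith
qed (simp add: x0_def)

text \<open>The truncation \<open>n\<close> is independent of the number \<open>k\<close> of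
  retreats followed, because the drift is needed for every truncation.\<close>

lemma bounds_score_trees:
  assumes "bounds (mean p0 (map_dtree weight h)) s"
  shows "bounds (mean_score p0 x0 (map_dtree weight h) n) (score_trees k s)"
  using assms
proof (induction k arbitrary: n s)
  case 0
  have "mean_score p0 x0 (map_dtree weight h) n c a \<le> 2 ^ 24" for c a
  proof (induction n arbitrary: c a)
    case (Suc n)
    let ?u = "mean p0 (map_dtree weight h) (a 0) (a \<circ> Suc)"
    let ?s = "mean_score p0 x0 (map_dtree weight h) n (a 0) (a \<circ> Suc)"
    have u: "?u \<le> 2 ^ 24"
      using weight_leaf by (intro mean_le p0) blast
    have "x0 * ?s \<le> 1 * ?s"
      using score_ge_0 by (intro mult_right_mono) (simp_all add: x0_def)
    also have "\<dots> \<le> 2 ^ 24" using Suc by simp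
    finally have "x0 * ?s \<le> 2 ^ 24" .
    from convex_le[OF occ_bounds[OF p0] u this] show ?case
      by (simp add: algebra_simps)
  qed simp
  moreover have "weight End = 2 ^ 24" by (simp add: weight_def)
  ultimately show ?case by (simp add: bounds_def)
next
  case (Suc k)
  have step: "bounds (mean_score p0 x0 (map_dtree weight h) (Suc m)) (score_trees (Suc k) s)" for m
    using bounds_combine[OF bounds_discount[OF Suc.IH[OF bounds_squash[OF Suc.prems]]] Suc.prems]
    unfolding bounds_def by simp
  show ?case
  proof (cases n)
    case 0
    \<comment> \<open>The empty score 0 is at most the nonnegative score truncated at one site, to
      which the tree bound applies.\<close>
    show ?thesis
      using step[of 0] score_ge_0[of "Suc 0"] unfolding bounds_def 0 mean_score.simps(1)
      by (meson order_trans)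
  next
    case (Suc m)
    show ?thesis unfolding Suc by (rule step)
  qed
qed

text \<open>Empty sites in front of the edge give a factor \<open>x0\<close> on both sides, so the
  edge may be taken at index 0. The child in front of it is then occupied with probability
  \<open>p0\<close>, and the certificate compares the two outcomes with the old weight.\<close>

lemma drift:
  assumes "certifies_aux k h (mean_trees h)"
  shows "mean_score p0 x0 (map_dtree weight h) m False a \<le> K0 * score x0 (map_dtree weight h) m a"
proof (induction m arbitrary: a)
  case (Suc m)
  let ?h = "map_dtree weight h" and ?a = "a \<circ> Suc"
  show ?case
  proof (cases "a 0")
    case True
    let ?s = "snd (mean_trees h)"
    let ?w = "map_dtree discount (snd (score_trees k (map_both squash (mean_trees h))))"
    have s: "mean p0 ?h True ?a \<le> weight (look ?s ?a)"
      using bounds_mean_trees[of h] by (simp add: bounds_def)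
    have "mean_score p0 x0 ?h m True ?a
        \<le> weight (look (snd (score_trees k (map_both squash (mean_trees h)))) ?a)"
      using bounds_score_trees[OF bounds_squash[OF bounds_mean_trees], of m k]
      by (simp add: bounds_def)
    then have "x0 * mean_score p0 x0 ?h m True ?a
        \<le> x0 * weight (look (snd (score_trees k (map_both squash (mean_trees h)))) ?a)"
      by (simp add: x0_def)
    also have "\<dots> \<le> weight (look ?w ?a)"
      by (simp add: look_map_dtree weight_discount)
    finally have w: "x0 * mean_score p0 x0 ?h m True ?a \<le> weight (look ?w ?a)" .
    have "mean_score p0 x0 ?h (Suc m) False a
        = p0 * mean p0 ?h True ?a + (1 - p0) * (x0 * mean_score p0 x0 ?h m True ?a)"
      using True by (simp add: occ_def)
    also have "\<dots> \<le> weight (look (zip_dtree mix ?s ?w) ?a)"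
      by (rule weight_zip_mix[OF s w])
    also have "\<dots> \<le> K0 * weight (look h ?a)"
    proof (rule weight_shrinks)
      have "look (zip_dtree shrinks (zip_dtree mix ?s ?w) h) ?a"
        using assms look_in_set by (auto simp: certifies_aux_def dtree.pred_set)
      then show "shrinks (look (zip_dtree mix ?s ?w) ?a) (look h ?a)"
        by (simp add: look_zip_dtree)
    qed
    finally show ?thesis using True by (simp add: look_map_dtree)
  next
    case False
    then show ?thesis
      using mult_left_mono[OF Suc, of x0 ?a] by (simp add: occ_def x0_def mult_ac comp_def)
  qed
qed simp

end

lemma certifies_extinction:
  assumes "certifies n h"
  shows "percolation_prob p0 = 0"
proof (rule percolation_prob_eq_0[where x = x0 and K = K0 and lo = 1 and h = "map_dtree weight h"])
  have h: "pred_dtree (\<lambda>g. lt g cap) h" and n: "certifies_aux n h (mean_trees h)"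
    using assms by (auto simp: certifies_def)
  show "1 \<le> v" if "v \<in> set_dtree (map_dtree weight h)" for v
    using weight_leaf[OF h that] by simp
  show "mean_score p0 x0 (map_dtree weight h) m False a \<le> K0 * score x0 (map_dtree weight h) m a" for m a
    by (rule drift[OF h n])
qed (simp_all add: p0_def x0_def K0_def power2_eq_square)

subsection \<open>The certificate\<close>

fun pair_up :: "'a dtree list \<Rightarrow> 'a dtree list" where
  "pair_up (s # t # ts) = Node s t # pair_up ts"
| "pair_up [t] = [t]"
| "pair_up [] = []"

text \<open>The first round pairs neighbours, so the lowest bit of an index belongs to the farthest
  site.\<close>

primrec merge :: "nat \<Rightarrow> 'a dtree list \<Rightarrow> 'a dtree" where
  "merge 0 ts = hd ts"
| "merge (Suc n) ts = merge n (pair_up ts)"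

text \<open>The defects of the leading eigenfunction of the drift operator for a window of eleven sites,
  found by power iteration and rounded. The bits of the index of an entry give
  the occupation of the ten sites behind the edge, the nearest one first.\<close>

definition defects :: "nat list" where
  "defects = [
    117937, 111163, 101485, 99944, 91636, 89145, 87478, 86732, 82224, 79138, 76193, 75481, 75148,
    73706, 73069, 72627, 73451, 69978, 66317, 65561, 63590, 62317, 61674, 61295, 63449, 61487,
    59946, 59494, 59778, 58847, 58511, 58223, 65494, 61771, 57641, 56847, 54062, 52797, 52085,
    51718, 51785, 50097, 48718, 48333, 48446, 47666, 47370, 47130, 52666, 50340, 48168, 47669,
    46825, 45982, 45599, 45349, 47314, 45981, 45013, 44706, 45011, 44374, 44165, 43966, 58674,
    54798, 50324, 49507, 46180, 44903, 44130, 43764, 42875, 41258, 39857, 39493, 39471, 38741,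
    38438, 38217, 41162, 39180, 37277, 36855, 36037, 35328, 34992, 34784, 36293, 35186, 34360,
    34107, 34333, 33809, 33628, 33466, 43143, 40576, 37937, 37402, 35832, 34984, 34528, 34285,
    34819, 33667, 32763, 32502, 32635, 32107, 31912, 31750, 36072, 34444, 32972, 32625, 32144,
    31555, 31295, 31121, 32615, 31676, 31009, 30793, 31035, 30587, 30441, 30302, 53738, 49768,
    44991, 44162, 40363, 39075, 38246, 37881, 36339, 34740, 33278, 32923, 32795, 32086, 31765,
    31553, 33374, 31508, 29625, 29232, 28304, 27647, 27312, 27122, 28387, 27369, 26567, 26337,
    26497, 26022, 25844, 25699, 32323, 30138, 27814, 27362, 25907, 25193, 24788, 24585, 24904,
    23939, 23151, 22935, 23015, 22577, 22404, 22272, 25796, 24443, 23179, 22893, 22441, 21957,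
    21731, 21590, 22804, 22032, 21462, 21286, 21468, 21103, 20976, 20864, 35560, 32834, 29808,
    29250, 27098, 26233, 25707, 25465, 25132, 24029, 23074, 22831, 22825, 22337, 22128, 21982,
    24527, 23145, 21818, 21528, 20984, 20497, 20260, 20119, 21226, 20460, 19880, 19707, 19864,
    19505, 19376, 19266, 26655, 24820, 22927, 22549, 21459, 20860, 20530, 20361, 20851, 20031,
    19376, 19193, 19289, 18916, 18772, 18660, 21903, 20733, 19659, 19412, 19069, 18650, 18457,
    18335, 19443, 18770, 18279, 18126, 18298, 17978, 17869, 17772, 52670, 48597, 43426, 42585,
    38213, 36908, 36003, 35639, 33437, 31827, 30260, 29908, 29670, 28964, 28616, 28408, 29472,
    27630, 25657, 25274, 24181, 23543, 23188, 23005, 24129, 23140, 22308, 22088, 22192, 21737,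
    21548, 21412, 26842, 24777, 22457, 22035, 20458, 19791, 19383, 19197, 19277, 18381, 17603,
    17406, 17432, 17031, 16857, 16738, 19948, 18698, 17464, 17204, 16693, 16253, 16029, 15903,
    16978, 16274, 15722, 15565, 15702, 15373, 15248, 15149, 26598, 24248, 21506, 21029, 18978,
    18241, 17759, 17556, 17082, 16142, 15281, 15077, 15026, 14616, 14423, 14303, 16366, 15192,
    14006, 13763, 13227, 12820, 12605, 12489, 13400, 12757, 12240, 12097, 12206, 11908, 11791,
    11702, 18042, 16493, 14819, 14504, 13479, 12980, 12685, 12546, 12885, 12201, 11624, 11474,
    11527, 11220, 11091, 11000, 13762, 12784, 11840, 11637, 11298, 10952, 10781, 10681, 11598,
    11040, 10611, 10486, 10611, 10350, 10252, 10174, 31509, 28646, 25199, 24622, 21856, 20970,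
    20364, 20122, 19044, 17941, 16886, 16648, 16517, 16041, 15805, 15667, 17205, 15899, 14529,
    14260, 13557, 13109, 12861, 12735, 13622, 12923, 12339, 12185, 12272, 11952, 11818, 11723,
    17081, 15513, 13782, 13464, 12353, 11852, 11546, 11408, 11635, 10954, 10366, 10217, 10251,
    9947, 9815, 9726, 12366, 11402, 10454, 10255, 9890, 9551, 9378, 9282, 10157, 9613, 9184,
    9063, 9176, 8922, 8824, 8749, 20313, 18311, 16001, 15599, 13919, 13298, 12891, 12721, 12458,
    11660, 10930, 10758, 10724, 10377, 10213, 10112, 12127, 11115, 10094, 9886, 9441, 9091, 8905,
    8806, 9623, 9069, 8621, 8498, 8596, 8340, 8237, 8161, 13921, 12564, 11096, 10822, 9944, 9509,
    9249, 9128, 9481, 8881, 8373, 8241, 8291, 8023, 7908, 7829, 10325, 9461, 8625, 8446, 8153,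
    7848, 7696, 7609, 8435, 7942, 7560, 7450, 7562, 7332, 7244, 7175, 62161, 57695, 51650, 50740,
    45346, 43923, 42855, 42463, 39349, 37590, 35764, 35384, 35008, 34243, 33830, 33609, 34013,
    32014, 29739, 29328, 27955, 27269, 26854, 26661, 27775, 26707, 25752, 25518, 25581, 25094,
    24873, 24730, 29725, 27535, 24922, 24479, 22577, 21876, 21412, 21219, 21076, 20134, 19263,
    19059, 19036, 18619, 18421, 18299, 21639, 20327, 18954, 18684, 18048, 17591, 17339, 17210,
    18300, 17567, 16955, 16793, 16908, 16569, 16427, 16327, 27156, 24776, 21836, 21359, 19031,
    18290, 17768, 17567, 16816, 15871, 14952, 14750, 14647, 14238, 14029, 13911, 15772, 14598,
    13345, 13105, 12481, 12078, 11848, 11735, 12605, 11967, 11423, 11283, 11367, 11074, 10948,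
    10862, 17268, 15728, 13973, 13664, 12517, 12026, 11713, 11578, 11805, 11131, 10530, 10384,
    10407, 10108, 9971, 9884, 12638, 11674, 10694, 10496, 10102, 9765, 9584, 9489, 10376, 9831,
    9386, 9266, 9371, 9118, 9014, 8940, 27770, 25126, 21752, 21226, 18392, 17581, 16981, 16763,
    15496, 14484, 13453, 13238, 13060, 12628, 12393, 12270, 13500, 12302, 10970, 10728, 9989,
    9584, 9339, 9227, 10005, 9369, 8802, 8664, 8717, 8429, 8297, 8213, 13097, 11667, 9998, 9712,
    8579, 8127, 7829, 7706, 7825, 7210, 6644, 6512, 6514, 6244, 6114, 6036, 8473, 7599, 6690,
    6512, 6125, 5823, 5655, 5570, 6353, 5864, 5454, 5347, 5431, 5206, 5110, 5044, 15895, 14082,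
    11877, 11517, 9837, 9280, 8888, 8738, 8365, 7649, 6954, 6802, 6736, 6429, 6270, 6182, 7961,
    7053, 6083, 5899, 5439, 5129, 4950, 4864, 5583, 5089, 4665, 4557, 4626, 4401, 4301, 4236,
    9605, 8385, 6993, 6750, 5870, 5483, 5234, 5129, 5389, 4855, 4374, 4259, 4281, 4046, 3935,
    3867, 6157, 5385, 4595, 4437, 4130, 3862, 3715, 3640, 4374, 3938, 3577, 3482, 3566, 3365,
    3280, 3221, 35361, 32195, 28039, 27413, 23759, 22794, 22055, 21797, 19844, 18650, 17394,
    17142, 16871, 16366, 16078, 15935, 16695, 15317, 13733, 13455, 12504, 12042, 11751, 11624,
    12418, 11696, 11029, 10874, 10905, 10581, 10424, 10331, 14838, 13272, 11390, 11079, 9725,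
    9234, 8897, 8764, 8731, 8068, 7437, 7296, 7272, 6982, 6837, 6753, 9273, 8339, 7338, 7148,
    6684, 6363, 6177, 6088, 6886, 6367, 5920, 5807, 5882, 5645, 5539, 5470, 15253, 13431, 11166,
    10807, 9030, 8473, 8069, 7920, 7427, 6714, 6003, 5853, 5766, 5462, 5299, 5212, 6851, 5953,
    4973, 4792, 4303, 3998, 3816, 3732, 4420, 3935, 3508, 3403, 3460, 3240, 3140, 3076, 8303,
    7108, 5716, 5479, 4571, 4195, 3945, 3843, 4051, 3531, 3052, 2941, 2952, 2724, 2613, 2547,
    4772, 4022, 3239, 3086, 2766, 2507, 2361, 2289, 2993, 2571, 2214, 2122, 2197, 2004, 1919,
    1863, 20133, 17871, 14975, 14530, 12104, 11421, 10904, 10723, 9688, 8833, 7948, 7769, 7607,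
    7247, 7044, 6942, 8156, 7136, 5985, 5780, 5138, 4797, 4584, 4490, 5164, 4626, 4135, 4020,
    4058, 3817, 3701, 3631, 8168, 6930, 5465, 5220, 4224, 3836, 3573, 3469, 3588, 3058, 2561,
    2448, 2444, 2213, 2098, 2032, 4199, 3443, 2642, 2489, 2143, 1883, 1733, 1662, 2347, 1925,
    1563, 1472, 1540, 1347, 1261, 1205, 11062, 9469, 7504, 7190, 5689, 5204, 4853, 4723, 4409,
    3783, 3163, 3031, 2965, 2698, 2556, 2480, 4126, 3326, 2458, 2297, 1880, 1609, 1447, 1373,
    2012, 1579, 1199, 1105, 1161, 964, 874, 818, 5684, 4604, 3351, 3137, 2338, 1999, 1773, 1682,
    1918, 1446, 1013, 913, 926, 719, 619, 560, 2627, 1944, 1230, 1092, 809, 573, 439, 374, 1029,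
    643, 317, 234, 304, 128, 51, 0]"

text \<open>One \<open>shrinks\<close> inequality for each of the 1024 patterns, by evaluation. Ten
  retreats exhaust the window; the numeral is spelled with \<open>Suc\<close> to match the recursion
  equations.\<close>

lemma defects_certify:
  "certifies (Suc (Suc (Suc (Suc (Suc (Suc (Suc (Suc (Suc (Suc 0))))))))))
     (merge (Suc (Suc (Suc (Suc (Suc (Suc (Suc (Suc (Suc (Suc 0))))))))))
       (map (\<lambda>n. Leaf (encode n)) defects))"
  by (simp only: defects_def list.map encode_numeral merge.simps pair_up.simps list.sel
      certifies_def certifies_aux_def mean_trees.simps score_trees.simps combine.simps
      combine_aux.simps map_both.simps squash.simps zip_dtree.simps dtree.map dtree.pred_inject
      prod.sel min_bits_def choose_bits.simps mix_def discount_def shrinks_def shift10.simps cap_def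
      avg.simps half.simps inc.simps add.simps addc.simps le.simps lt.simps simp_thms)

theorem mainTheorem2:
  shows "critical_prob \<ge> 0.63328"
proof -
  have "p0 \<in> {p \<in> {0..1}. percolation_prob p = 0}"
    using certifies_extinction[OF defects_certify] p0 by simp
  then have "p0 \<le> critical_prob"
    unfolding critical_prob_def by (intro cSup_upper) (auto intro!: bdd_aboveI[of _ 1])
  then show ?thesis by (simp add: p0_def)
qed

end
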